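(* Let $d\ge 1$, $\delta=(2+2d)^{-1/2}$, $\underline u=\frac12-\delta$, $\overline u=\frac12+\delta$, and let $M>0$ be a real number. Let $u\in C^3(\overline Q)$ be a solution of $$u_t=\operatorname{div}\bigl(u(1-u)Du\bigr)\quad\text{in }Q,\qquad u(x,0)=u_0(x)\quad\text{for }x\in\mathbb{T}^d,$$ such that for all $t\ge 0$ $$\underline u\le u(\cdot,t)\le\overline u\quad\text{and}\quad\|Du(\cdot,t)\|_{L^\infty(\mathbb{T}^d)}\le M.$$ Then for all $t\ge 0$ $$\min_{\mathbb{T}^d}u_0\le u(\cdot,t)\le\max_{\mathbb{T}^d}u_0\quad\text{and}\quad\|Du(\cdot,t)\|_{L^\infty(\mathbb{T}^d)}\le\|Du_0\|_{L^\infty(\mathbb{T}^d)}.$$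
   Context: $\mathbb{T}^d=(\mathbb{R}/\mathbb{Z})^d$ is the $d$-dimensional torus, $Q:=\mathbb{T}^d\times(0,+\infty)$ and $\overline Q=\mathbb{T}^d\times[0,+\infty)$. $Du$ is the gradient of $u$ in the space variable $x$ and $\operatorname{div}$ is the divergence in $x$. $\|Du(\cdot,t)\|_{L^\infty(\mathbb{T}^d)}$ is the supremum over $x\in\mathbb{T}^d$ of the Euclidean norm $|Du(x,t)|$. *)

theory Defs
  imports "HOL-Analysis.Analysis"
begin

text \<open>
  Functions on the torus \<open>(\<real>/\<int>)\<^sup>d\<close> are represented by functions on
  \<open>real ^ 'n\<close>, \<open>d = CARD('n)\<close>, that have period 1 in every coordinate.
\<close>

definition periodic1 :: "(real ^ 'n \<Rightarrow> 'b) \<Rightarrow> bool" where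
  "periodic1 f \<longleftrightarrow> (\<forall>x i. f (x + axis i 1) = f x)"

text \<open>
  \<open>k\<close>-fold continuous differentiability on a set. It is meant for convex sets with
  nonempty interior, such as a closed half-space, where derivatives within the set are unique;
  at boundary points they are the one-sided ones. The quantifier over \<open>v\<close> makes every
  component of the derivative \<open>k\<close> times continuously differentiable.
\<close>

primrec Ck_on :: "nat \<Rightarrow> 'a::euclidean_space set \<Rightarrow> ('a \<Rightarrow> real) \<Rightarrow> bool" where
  "Ck_on 0 S f \<longleftrightarrow> continuous_on S f"
| "Ck_on (Suc k) S f \<longleftrightarrow>
     (\<exists>f'. (\<forall>p\<in>S. (f has_derivative f' p) (at p within S)) \<and> (\<forall>v. Ck_on k S (\<lambda>p. f' p v)))"

text \<open>
  Partial derivatives, gradient and divergence in space. The values are arbitrary where the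
  partial derivatives do not exist.
\<close>

definition partial :: "'n \<Rightarrow> (real ^ 'n \<Rightarrow> real) \<Rightarrow> real ^ 'n \<Rightarrow> real" where
  "partial i f x = deriv (\<lambda>s. f (x + s *\<^sub>R axis i 1)) 0"

definition grad :: "(real ^ 'n \<Rightarrow> real) \<Rightarrow> real ^ 'n \<Rightarrow> real ^ 'n" where
  "grad f x = (\<chi> i. partial i f x)"

definition divergence :: "(real ^ 'n \<Rightarrow> real ^ 'n) \<Rightarrow> real ^ 'n \<Rightarrow> real" where
  "divergence F x = (\<Sum>i\<in>UNIV. partial i (\<lambda>y. F y $ i) x)"

text \<open>
  Supremum of the Euclidean norm. It is used only for continuous periodic fields, for which the
  set of values is bounded, so the real-valued supremum is the genuine one.
\<close>

definition sup_norm :: "(real ^ 'n \<Rightarrow> real ^ 'n) \<Rightarrow> real" where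
  "sup_norm F = (SUP x. norm (F x))"

end

theory Submission
  imports Defs
begin

text \<open>
  Both bounds come from the maximum principle on the torus: if the time derivative of \<open>w\<close> is
  nonpositive at every spatial maximum of \<open>w(\<cdot>, t)\<close>, then \<open>max w(\<cdot>, t)\<close> does not exceed
  \<open>max w(\<cdot>, 0)\<close>. For \<open>w = \<plusminus>u\<close> this is immediate from \<open>u(1 - u) \<ge> 0\<close>. For \<open>w = |Du|\<^sup>2\<close>, write
  \<open>a = u(1 - u)\<close>, \<open>b = 1 - 2u\<close> and \<open>H = D\<^sup>2u\<close>. Differentiating the equation gives, at a spatial
  maximum of \<open>w\<close>, \<open>w\<^sub>t \<le> - 2a|H|\<^sup>2 + 2b w tr H - 4w\<^sup>2\<close>. There \<open>Dw = 0\<close>, so \<open>H\<close>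
  annihilates \<open>Du\<close> and \<open>(tr H)\<^sup>2 \<le> (d - 1)|H|\<^sup>2\<close>. The right-hand side is therefore nonpositive
  as soon as \<open>b\<^sup>2(d - 1) \<le> 8a\<close>, which is equivalent to \<open>|u - 1/2| \<le> \<delta>\<close>.
\<close>

section \<open>Directional derivatives and C^k functions on open sets\<close>

text \<open>With the direction as first argument, \<open>ddir v f\<close> is again a function of the
  point, so derivatives can be iterated, and space and time directions are treated alike.\<close>

definition ddir :: "'a::real_normed_vector \<Rightarrow> ('a \<Rightarrow> real) \<Rightarrow> 'a \<Rightarrow> real" where
  "ddir v f p = frechet_derivative f (at p) v"

lemma ddir_eq: "(f has_derivative f') (at p) \<Longrightarrow> ddir v f p = f' v"
  by (simp add: ddir_def frechet_derivative_at[symmetric])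

lemma has_derivative_ddir: "f differentiable (at p) \<Longrightarrow> (f has_derivative (\<lambda>v. ddir v f p)) (at p)"
  by (simp add: ddir_def frechet_derivative_works[symmetric])

lemma has_real_derivative_along:
  assumes f: "(f has_derivative f') (at (g s))" and g: "(g has_vector_derivative v) (at s)"
  shows "((\<lambda>s. f (g s)) has_real_derivative f' v) (at s)"
proof -
  interpret bounded_linear f'
    using f by (rule has_derivative_bounded_linear)
  from has_derivative_compose[OF g[unfolded has_vector_derivative_def] f]
  show ?thesis by (simp add: has_field_derivative_def scaleR mult_commute_abs)
qed

lemmas has_real_derivative_ddir = has_real_derivative_along[OF has_derivative_ddir]

lemma ddir_transform:
  assumes "open S" "p \<in> S" "\<And>q. q \<in> S \<Longrightarrow> f q = g q" "f differentiable (at p)"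
  shows "ddir v f p = ddir v g p"
  unfolding ddir_def by (simp add: frechet_derivative_transform_within_open[OF assms(4,1,2,3)])

lemma Ck_on_subset: "Ck_on k S f \<Longrightarrow> T \<subseteq> S \<Longrightarrow> Ck_on k T f"
proof (induction k arbitrary: f)
  case 0
  then show ?case using continuous_on_subset by auto
next
  case (Suc k)
  then obtain f' where "\<forall>p\<in>S. (f has_derivative f' p) (at p within S)" "\<forall>v. Ck_on k S (\<lambda>p. f' p v)"
    by auto
  with Suc have "\<forall>p\<in>T. (f has_derivative f' p) (at p within T)" "\<forall>v. Ck_on k T (\<lambda>p. f' p v)"
    using has_derivative_subset by blast+
  then show ?case by auto
qed

lemma Ck_on_cong: "(\<And>p. p \<in> S \<Longrightarrow> f p = g p) \<Longrightarrow> Ck_on k S f \<Longrightarrow> Ck_on k S g"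
proof (induction k arbitrary: f g)
  case 0
  then show ?case using continuous_on_cong by fastforce
next
  case (Suc k)
  then obtain f' where "\<forall>p\<in>S. (f has_derivative f' p) (at p within S)" "\<forall>v. Ck_on k S (\<lambda>p. f' p v)"
    by auto
  then have "\<forall>p\<in>S. (g has_derivative f' p) (at p within S)"
    using Suc.prems(1) by (intro ballI has_derivative_transform[of _ S g f]) auto
  with \<open>\<forall>v. Ck_on k S (\<lambda>p. f' p v)\<close> show ?case by auto
qed

lemma Ck_on_imp_continuous_on: "Ck_on k S f \<Longrightarrow> continuous_on S f"
proof (cases k)
  case (Suc m)
  assume "Ck_on k S f"
  with Suc obtain f' where "\<forall>p\<in>S. (f has_derivative f' p) (at p within S)"
    by auto
  then show ?thesis
    unfolding continuous_on_eq_continuous_within using has_derivative_continuous by blast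
qed simp

lemma Ck_on_SucD: "Ck_on (Suc k) S f \<Longrightarrow> Ck_on k S f"
proof (induction k arbitrary: f)
  case 0
  then show ?case using Ck_on_imp_continuous_on Ck_on.simps(1) by blast
next
  case (Suc k)
  from Suc.prems obtain f' where "\<forall>p\<in>S. (f has_derivative f' p) (at p within S)"
    "\<forall>v. Ck_on (Suc k) S (\<lambda>p. f' p v)"
    by (subst (asm) Ck_on.simps(2)) blast
  with Suc.IH show ?case by (subst Ck_on.simps(2)) blast
qed

text \<open>On an open set the derivative within the set is the ordinary, hence unique, derivative,
  so the witness in \<open>Ck_on\<close> can be replaced by \<open>ddir\<close>.\<close>

lemma Ck_on_Suc_open:
  assumes "Ck_on (Suc k) S f" and "open S"
  shows "p \<in> S \<Longrightarrow> f differentiable (at p)" and "Ck_on k S (ddir v f)"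
proof -
  obtain f' where f': "\<forall>p\<in>S. (f has_derivative f' p) (at p within S)" "\<forall>v. Ck_on k S (\<lambda>p. f' p v)"
    using assms by auto
  then have *: "(f has_derivative f' p) (at p)" if "p \<in> S" for p
    using that assms(2) at_within_open by metis
  show "p \<in> S \<Longrightarrow> f differentiable (at p)"
    using * differentiable_def by blast
  show "Ck_on k S (ddir v f)"
  proof (rule Ck_on_cong)
    show "Ck_on k S (\<lambda>p. f' p v)" using f' by blast
    show "f' p v = ddir v f p" if "p \<in> S" for p
      using ddir_eq[OF *[OF that]] by simp
  qed
qed

section \<open>Symmetry of second derivatives\<close>

text \<open>Two applications of the mean value theorem: first in direction \<open>v\<close> to the
  difference of \<open>f\<close> across the step \<open>h *\<^sub>R w\<close>, then in direction
  \<open>w\<close> to \<open>ddir v f\<close>.\<close>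

lemma second_difference_mean_value:
  assumes "\<And>a b. 0 \<le> a \<Longrightarrow> a \<le> h \<Longrightarrow> 0 \<le> b \<Longrightarrow> b \<le> h \<Longrightarrow> p + a *\<^sub>R v + b *\<^sub>R w \<in> S"
    and f: "\<And>q. q \<in> S \<Longrightarrow> f differentiable (at q)"
    and fv: "\<And>q. q \<in> S \<Longrightarrow> ddir v f differentiable (at q)"
    and "h > 0"
  obtains a b where "0 < a" "a < h" "0 < b" "b < h"
    "f (p + h *\<^sub>R v + h *\<^sub>R w) - f (p + h *\<^sub>R v) - f (p + h *\<^sub>R w) + f p =
       h * (h * ddir w (ddir v f) (p + a *\<^sub>R v + b *\<^sub>R w))"
proof -
  let ?g = "\<lambda>s. f (p + s *\<^sub>R v + h *\<^sub>R w) - f (p + s *\<^sub>R v + 0 *\<^sub>R w)"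
  let ?g' = "\<lambda>s. ddir v f (p + s *\<^sub>R v + h *\<^sub>R w) - ddir v f (p + s *\<^sub>R v + 0 *\<^sub>R w)"
  have "(?g has_real_derivative ?g' s) (at s)" if "0 \<le> s" "s \<le> h" for s
    by (intro DERIV_diff has_real_derivative_ddir f assms(1))
       (use that \<open>h > 0\<close> in \<open>auto intro!: derivative_eq_intros\<close>)
  from MVT2[OF \<open>h > 0\<close> this] obtain a where a: "0 < a" "a < h" "?g h - ?g 0 = h * ?g' a"
    by auto
  have "((\<lambda>s. ddir v f (p + a *\<^sub>R v + s *\<^sub>R w)) has_real_derivative
          ddir w (ddir v f) (p + a *\<^sub>R v + s *\<^sub>R w)) (at s)" if "0 \<le> s" "s \<le> h" for s
    by (intro has_real_derivative_ddir fv assms(1))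
       (use that a in \<open>auto intro!: derivative_eq_intros\<close>)
  from MVT2[OF \<open>h > 0\<close> this] obtain b where "0 < b" "b < h"
    "?g' a = h * ddir w (ddir v f) (p + a *\<^sub>R v + b *\<^sub>R w)"
    by auto
  with a that[of a b] show ?thesis by simp
qed

text \<open>The second difference is unchanged when \<open>v\<close> and \<open>w\<close> are
  exchanged, so the two mixed derivatives take a common value at points near \<open>p\<close>;
  continuity carries this to \<open>p\<close>.\<close>

lemma ddir_commute:
  fixes S :: "'a::euclidean_space set"
  assumes C: "Ck_on 2 S f" and "open S" "p \<in> S"
  shows "ddir v (ddir w f) p = ddir w (ddir v f) p"
proof (rule ccontr)
  assume ne: "\<not> ?thesis"
  \<comment> \<open>Half the supposed gap: two equal values, each less than \<open>e\<close> away
    from one of the mixed derivatives at \<open>p\<close>, force these to differ by less than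
    \<open>2 * e\<close>.\<close>
  define e where "e = \<bar>ddir v (ddir w f) p - ddir w (ddir v f) p\<bar> / 2"
  have "e > 0" using ne by (simp add: e_def)
  have C2: "Ck_on (Suc (Suc 0)) S f" using C by (simp add: numeral_2_eq_2)
  note f = Ck_on_Suc_open(1)[OF C2 \<open>open S\<close>] and C1 = Ck_on_Suc_open(2)[OF C2 \<open>open S\<close>]
  note fv = Ck_on_Suc_open(1)[OF C1 \<open>open S\<close>]
  have cont: "isCont (ddir x (ddir y f)) p" for x y
    using Ck_on_Suc_open(2)[OF C1 \<open>open S\<close>] \<open>open S\<close> \<open>p \<in> S\<close>
    by (simp add: continuous_on_eq_continuous_at)
  have "\<exists>d>0. \<forall>q. dist q p < d \<longrightarrow> q \<in> S \<and> \<bar>ddir v (ddir w f) q - ddir v (ddir w f) p\<bar> < e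
          \<and> \<bar>ddir w (ddir v f) q - ddir w (ddir v f) p\<bar> < e"
  proof -
    have "\<forall>\<^sub>F q in nhds p. q \<in> S"
      using \<open>open S\<close> \<open>p \<in> S\<close> eventually_nhds by blast
    moreover have "\<forall>\<^sub>F q in nhds p. dist (ddir x (ddir y f) q) (ddir x (ddir y f) p) < e" for x y
      using cont[of x y] \<open>e > 0\<close> tendstoD unfolding isCont_def tendsto_at_iff_tendsto_nhds by blast
    ultimately have "\<forall>\<^sub>F q in nhds p. q \<in> S \<and> dist (ddir v (ddir w f) q) (ddir v (ddir w f) p) < e
          \<and> dist (ddir w (ddir v f) q) (ddir w (ddir v f) p) < e"
      by (intro eventually_conj)
    then show ?thesis
      unfolding eventually_nhds_metric dist_real_def by simp
  qed
  then obtain d where d: "d > 0" "\<And>q. dist q p < d \<Longrightarrow> q \<in> S"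
    "\<And>q. dist q p < d \<Longrightarrow> \<bar>ddir v (ddir w f) q - ddir v (ddir w f) p\<bar> < e"
    "\<And>q. dist q p < d \<Longrightarrow> \<bar>ddir w (ddir v f) q - ddir w (ddir v f) p\<bar> < e"
    by blast
  \<comment> \<open>Small enough for the parallelogram spanned at \<open>p\<close> to lie in the
    ball of radius \<open>d\<close>; the summand 1 makes the estimate strict and the denominator
    positive.\<close>
  define h where "h = d / (norm v + norm w + 1)"
  have pos: "norm v + norm w + 1 > 0" by (intro add_nonneg_pos) auto
  have h: "h > 0" using d pos by (simp add: h_def)
  have near: "dist (p + a *\<^sub>R v + b *\<^sub>R w) p < d" if "0 \<le> a" "a \<le> h" "0 \<le> b" "b \<le> h" for a b
  proof -
    have "dist (p + a *\<^sub>R v + b *\<^sub>R w) p = norm (a *\<^sub>R v + b *\<^sub>R w)"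
      by (simp add: dist_norm)
    also have "\<dots> \<le> a * norm v + b * norm w"
      using norm_triangle_ineq[of "a *\<^sub>R v" "b *\<^sub>R w"] that by simp
    also have "\<dots> \<le> h * norm v + h * norm w"
      using that by (intro add_mono mult_right_mono) auto
    also have "\<dots> < h * (norm v + norm w + 1)" using h by (simp add: algebra_simps)
    also have "\<dots> = d" using pos by (simp add: h_def)
    finally show ?thesis .
  qed
  obtain a b where ab: "0 < a" "a < h" "0 < b" "b < h"
    "f (p + h *\<^sub>R v + h *\<^sub>R w) - f (p + h *\<^sub>R v) - f (p + h *\<^sub>R w) + f p =
       h * (h * ddir w (ddir v f) (p + a *\<^sub>R v + b *\<^sub>R w))"
    by (rule second_difference_mean_value[of h p v w S f]) (use near d h f fv in auto)
  have near': "dist (p + a *\<^sub>R w + b *\<^sub>R v) p < d" if "0 \<le> a" "a \<le> h" "0 \<le> b" "b \<le> h" for a b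
    using near[of b a] that by (simp add: algebra_simps)
  obtain a' b' where ab': "0 < a'" "a' < h" "0 < b'" "b' < h"
    "f (p + h *\<^sub>R w + h *\<^sub>R v) - f (p + h *\<^sub>R w) - f (p + h *\<^sub>R v) + f p =
       h * (h * ddir v (ddir w f) (p + a' *\<^sub>R w + b' *\<^sub>R v))"
    by (rule second_difference_mean_value[of h p w v S f]) (use near' d h f fv in auto)
  have "h * (h * ddir w (ddir v f) (p + a *\<^sub>R v + b *\<^sub>R w)) =
        h * (h * ddir v (ddir w f) (p + a' *\<^sub>R w + b' *\<^sub>R v))"
    using ab(5) ab'(5) by (simp add: algebra_simps)
  then have "ddir w (ddir v f) (p + a *\<^sub>R v + b *\<^sub>R w) = ddir v (ddir w f) (p + a' *\<^sub>R w + b' *\<^sub>R v)"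
    using h by simp
  moreover have "\<bar>ddir w (ddir v f) (p + a *\<^sub>R v + b *\<^sub>R w) - ddir w (ddir v f) p\<bar> < e"
    using ab by (intro d(4) near) auto
  moreover have "\<bar>ddir v (ddir w f) (p + a' *\<^sub>R w + b' *\<^sub>R v) - ddir v (ddir w f) p\<bar> < e"
    using ab' by (intro d(3) near') auto
  ultimately show False
    unfolding e_def by (auto simp: abs_if field_simps split: if_splits)
qed

section \<open>Trace inequality and the algebra of the gradient estimate\<close>

text \<open>
  \<open>tr H = \<langle>H, P\<rangle>\<close> for the projection \<open>P = I - p p\<^sup>T / |p|\<^sup>2\<close>, and \<open>|P|\<^sup>2 = d - 1\<close>. The constant
  \<open>d - 1\<close> instead of \<open>d\<close> is what makes the range \<open>\<delta> = (2 + 2d)\<^sup>-\<^sup>1\<^sup>/\<^sup>2\<close> admissible.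
\<close>

lemma trace_sq_le:
  fixes p :: "'n::finite \<Rightarrow> real"
  assumes orth: "\<And>j. (\<Sum>k\<in>UNIV. p k * H k j) = 0" and "p k0 \<noteq> 0"
  shows "(\<Sum>j\<in>UNIV. H j j)\<^sup>2 \<le> (real CARD('n) - 1) * (\<Sum>k\<in>UNIV. \<Sum>j\<in>UNIV. (H k j)\<^sup>2)"
proof -
  define z where "z = (\<Sum>k\<in>UNIV. (p k)\<^sup>2)"
  have z: "z > 0" unfolding z_def by (rule sum_pos2[of _ k0]) (use assms in auto)
  define P where "P k j = (if k = j then 1 else 0) - p k * p j / z" for k j
  have "(\<Sum>k\<in>UNIV. \<Sum>j\<in>UNIV. H k j * P k j) =
      (\<Sum>k\<in>UNIV. \<Sum>j\<in>UNIV. (if k = j then H k j else 0)) - (\<Sum>k\<in>UNIV. \<Sum>j\<in>UNIV. p j / z * (p k * H k j))"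
    unfolding sum_subtractf[symmetric] by (intro sum.cong refl) (auto simp: P_def field_simps)
  also have "(\<Sum>k\<in>UNIV. \<Sum>j\<in>UNIV. p j / z * (p k * H k j)) = 0"
    by (subst sum.swap) (simp only: sum_distrib_left[symmetric] orth mult_zero_right sum.neutral_const)
  finally have tr: "(\<Sum>k\<in>UNIV. \<Sum>j\<in>UNIV. H k j * P k j) = (\<Sum>j\<in>UNIV. H j j)"
    by simp
  \<comment> \<open>The identity contributes d, the cross terms -2 and the rank-one part 1.\<close>
  have "(\<Sum>k\<in>UNIV. \<Sum>j\<in>UNIV. (P k j)\<^sup>2) =
     (\<Sum>k\<in>UNIV. \<Sum>j\<in>UNIV. (if k = j then 1 - 2 * (p k)\<^sup>2 / z else 0) + (p k)\<^sup>2 * (p j)\<^sup>2 / z\<^sup>2)"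
    by (intro sum.cong refl) (use z in \<open>auto simp: P_def power2_eq_square field_simps\<close>)
  also have "\<dots> = (\<Sum>k\<in>UNIV. 1 - 2 * (p k)\<^sup>2 / z) + (\<Sum>k\<in>UNIV. \<Sum>j\<in>UNIV. (p k)\<^sup>2 * (p j)\<^sup>2) / z\<^sup>2"
    by (simp add: sum.distrib sum_divide_distrib)
  also have "(\<Sum>k\<in>UNIV. \<Sum>j\<in>UNIV. (p k)\<^sup>2 * (p j)\<^sup>2) = z\<^sup>2"
    by (simp add: z_def power2_eq_square sum_product)
  also have "(\<Sum>k\<in>UNIV. 1 - 2 * (p k)\<^sup>2 / z) = real CARD('n) - 2 * z / z"
    by (simp add: sum_subtractf z_def sum_distrib_left sum_divide_distrib)
  finally have "(\<Sum>k\<in>UNIV. \<Sum>j\<in>UNIV. (P k j)\<^sup>2) = real CARD('n) - 1"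
    using z by simp
  \<comment> \<open>Cauchy-Schwarz for the Frobenius inner product, with matrices read as vectors
    indexed by pairs.\<close>
  moreover have "(\<Sum>k\<in>UNIV. \<Sum>j\<in>UNIV. H k j * P k j)\<^sup>2 \<le>
     (\<Sum>k\<in>UNIV. \<Sum>j\<in>UNIV. (H k j)\<^sup>2) * (\<Sum>k\<in>UNIV. \<Sum>j\<in>UNIV. (P k j)\<^sup>2)"
    using Cauchy_Schwarz_ineq_sum[of "\<lambda>(k, j). H k j" "\<lambda>(k, j). P k j" "UNIV \<times> UNIV"]
    by (simp add: sum.cartesian_product case_prod_unfold)
  ultimately show ?thesis by (simp add: tr mult.commute)
qed

text \<open>Pointwise algebra at a spatial maximum of |Du|^2: \<open>p\<close> is Du,
  \<open>H\<close> is D^2u, \<open>T k j\<close> is the second derivative of \<open>p k\<close> in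
  direction j, and \<open>R k\<close> is its time derivative, as given by the differentiated
  equation. Assumption \<open>max\<close> says that half the Laplacian of |Du|^2 is nonpositive; the
  conclusion says the same of half its time derivative.\<close>

lemma bochner_inequality:
  fixes p :: "'n::finite \<Rightarrow> real"
  assumes orth: "\<And>j. (\<Sum>k\<in>UNIV. p k * H k j) = 0"
    and max: "(\<Sum>k\<in>UNIV. \<Sum>j\<in>UNIV. (H k j)\<^sup>2 + p k * T k j) \<le> 0"
    and R: "\<And>k. R k = a * (\<Sum>j\<in>UNIV. T k j) + b * p k * (\<Sum>j\<in>UNIV. H j j)
              + 2 * b * (\<Sum>i\<in>UNIV. p i * H i k) - 2 * p k * (\<Sum>i\<in>UNIV. (p i)\<^sup>2)"
    and a: "a \<ge> 0" and ab: "b\<^sup>2 * (real CARD('n) - 1) \<le> 8 * a"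
  shows "(\<Sum>k\<in>UNIV. p k * R k) \<le> 0"
proof -
  define z where "z = (\<Sum>k\<in>UNIV. (p k)\<^sup>2)"
  define tr where "tr = (\<Sum>j\<in>UNIV. H j j)"
  define h where "h = (\<Sum>k\<in>UNIV. \<Sum>j\<in>UNIV. (H k j)\<^sup>2)"
  have h0: "h \<ge> 0" unfolding h_def by (intro sum_nonneg) auto
  \<comment> \<open>By \<open>orth\<close> the third term of \<open>R k\<close> vanishes.\<close>
  have "(\<Sum>k\<in>UNIV. p k * R k) =
     (\<Sum>k\<in>UNIV. a * (\<Sum>j\<in>UNIV. p k * T k j) + (b * tr) * (p k)\<^sup>2 - (2 * z) * (p k)\<^sup>2)"
    unfolding R orth by (intro sum.cong refl)
      (simp add: z_def tr_def sum_distrib_left[symmetric] algebra_simps power2_eq_square)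
  also have "\<dots> = a * (\<Sum>k\<in>UNIV. \<Sum>j\<in>UNIV. p k * T k j) + b * tr * z - 2 * z * z"
    by (simp add: sum.distrib sum_subtractf sum_distrib_left[symmetric] z_def)
  finally have 1: "(\<Sum>k\<in>UNIV. p k * R k) = \<dots>" .
  have "(\<Sum>k\<in>UNIV. \<Sum>j\<in>UNIV. p k * T k j) \<le> - h"
    using max by (simp add: sum.distrib h_def)
  then have 2: "a * (\<Sum>k\<in>UNIV. \<Sum>j\<in>UNIV. p k * T k j) \<le> - (a * h)"
    using a mult_left_mono by fastforce
  \<comment> \<open>If \<open>p\<close> is nonzero, the trace inequality and \<open>ab\<close> give
    \<open>(b * tr)\<^sup>2 \<le> 8 * (a * h)\<close>; expanding the square of
    \<open>b * tr - 4 * z\<close> and dividing by 8 gives the claim. If \<open>p\<close> vanishes,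
    so does \<open>z\<close>.\<close>
  have 3: "b * tr * z \<le> a * h + 2 * z * z"
  proof (cases "\<exists>k. p k \<noteq> 0")
    case True
    then have "tr\<^sup>2 \<le> (real CARD('n) - 1) * h"
      using trace_sq_le[of p H, OF orth] unfolding tr_def h_def by blast
    then have "b\<^sup>2 * tr\<^sup>2 \<le> b\<^sup>2 * ((real CARD('n) - 1) * h)"
      by (intro mult_left_mono) auto
    also have "\<dots> \<le> 8 * a * h"
      using mult_right_mono[OF ab h0] by (simp add: mult.assoc)
    finally have "(b * tr)\<^sup>2 \<le> 8 * (a * h)" by (simp add: power_mult_distrib)
    moreover have "0 \<le> (b * tr - 4 * z)\<^sup>2" by simp
    ultimately show ?thesis by (simp add: power2_eq_square algebra_simps)
  next
    case False
    then show ?thesis using a h0 by (simp add: z_def)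
  qed
  show ?thesis using 1 2 3 by linarith
qed

section \<open>Second derivative test in one variable\<close>

text \<open>If \<open>D\<close> were positive, then \<open>g'\<close>, being zero at
  \<open>x\<close>, would be positive just to the right of \<open>x\<close>, and the mean value
  theorem would give a value of \<open>g\<close> above the maximum.\<close>

lemma second_derivative_max_le_0:
  fixes g :: "real \<Rightarrow> real"
  assumes g: "\<And>s. (g has_real_derivative g' s) (at s)"
    and g': "(g' has_real_derivative D) (at x)" and max: "\<And>s. g s \<le> g x"
  shows "g' x = 0" and "D \<le> 0"
proof -
  show 0: "g' x = 0"
    using DERIV_local_max[OF g, of 1 x] max by auto
  show "D \<le> 0"
  proof (rule ccontr)
    assume "\<not> D \<le> 0"
    then obtain d where d: "d > 0" "\<And>h. 0 < h \<Longrightarrow> h < d \<Longrightarrow> 0 < g' (x + h)"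
      using DERIV_pos_inc_right[OF g'] 0 by auto
    obtain y where y: "x < y" "y < x + d / 2" "g (x + d / 2) - g x = (x + d / 2 - x) * g' y"
      using MVT2[of x "x + d / 2" g g'] g d(1) by auto
    have "0 < g' y" using d(2)[of "y - x"] y by simp
    then have "(x + d / 2 - x) * g' y > 0" using d(1) by simp
    then show False using y(3) max[of "x + d / 2"] by linarith
  qed
qed

section \<open>Periodic functions and compactness\<close>

lemma periodic1_add_nat: "periodic1 f \<Longrightarrow> f (x + of_nat n *\<^sub>R axis i 1) = f x"
proof (induction n)
  case (Suc n)
  have "f (x + of_nat (Suc n) *\<^sub>R axis i 1) = f (x + of_nat n *\<^sub>R axis i 1 + axis i 1)"
    by (simp add: algebra_simps)
  with Suc show ?case by (simp add: periodic1_def)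
qed simp

lemma periodic1_add_int:
  assumes "periodic1 f"
  shows "f (x + of_int n *\<^sub>R axis i 1) = f x"
proof (cases n)
  case (nonneg m)
  then show ?thesis using periodic1_add_nat[OF assms] by simp
next
  case (neg m)
  then have "of_int n + of_nat (Suc m) = (0 :: real)" by simp
  then have eq: "x + of_int n *\<^sub>R axis i 1 + of_nat (Suc m) *\<^sub>R axis i 1 = x"
    by (simp only: add.assoc scaleR_add_left[symmetric] scaleR_zero_left add_0_right)
  show ?thesis
    using periodic1_add_nat[OF assms, of "x + of_int n *\<^sub>R axis i 1" "Suc m" i]
    unfolding eq by (rule sym)
qed

text \<open>Coordinates are reduced modulo 1 one at a time, by induction on the set of reduced
  coordinates. This makes the compact unit cube stand for the torus.\<close>

lemma periodic1_frac:
  fixes x :: "real ^ 'n"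
  assumes "periodic1 f"
  shows "f (\<chi> i. frac (x $ i)) = f x"
proof -
  have "f (\<chi> i. if i \<in> A then frac (x $ i) else x $ i) = f x" if "finite A" for A
    using that
  proof induction
    case (insert j A)
    have "(\<chi> i. if i \<in> A then frac (x $ i) else x $ i) =
      (\<chi> i. if i \<in> insert j A then frac (x $ i) else x $ i) + of_int \<lfloor>x $ j\<rfloor> *\<^sub>R axis j 1"
      using insert(2) by (auto simp: vec_eq_iff frac_def axis_def)
    with insert.IH show ?case by (simp only: periodic1_add_int[OF assms])
  qed simp
  from this[of UNIV] show ?thesis by simp
qed

lemma frac_in_cbox: "(\<chi> i. frac (x $ i)) \<in> cbox 0 (1 :: real ^ 'n)"
  by (auto simp: mem_box_cart frac_lt_1 less_imp_le)

lemma range_periodic1: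
  fixes f :: "real ^ 'n \<Rightarrow> 'b"
  assumes "periodic1 f"
  shows "range f = f ` cbox 0 1"
proof -
  have "f x \<in> f ` cbox 0 1" for x
    using imageI[OF frac_in_cbox[of x], of f] periodic1_frac[OF assms, of x] by simp
  then show ?thesis by blast
qed

lemma compact_range_periodic1:
  fixes f :: "real ^ 'n \<Rightarrow> 'b::topological_space"
  assumes "periodic1 f" "continuous_on UNIV f"
  shows "compact (range f)"
  unfolding range_periodic1[OF assms(1)]
  using assms(2) by (intro compact_continuous_image compact_cbox) (auto intro: continuous_on_subset)

section \<open>Maximum principle on the torus\<close>

text \<open>Subtracting \<open>e * t\<close> makes the time derivative strictly negative at spatial
  maxima, so the maximum over the cube and the time interval cannot sit at a positive time: slightly
  earlier values would be larger. Hence it sits at time 0, and \<open>e\<close> is arbitrary. Only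
  the behaviour at spatial maxima enters, so one lemma serves u, -u and |Du|^2.\<close>

lemma periodic_maximum_principle:
  fixes w :: "real ^ 'n \<Rightarrow> real \<Rightarrow> real"
  assumes cont: "continuous_on (UNIV \<times> {0..}) (\<lambda>(x, t). w x t)"
    and per: "\<And>t. t \<ge> 0 \<Longrightarrow> periodic1 (\<lambda>x. w x t)"
    and max: "\<And>x t. t > 0 \<Longrightarrow> (\<And>y. w y t \<le> w x t) \<Longrightarrow> \<exists>D\<le>0. (w x has_real_derivative D) (at t)"
    and init: "\<And>x. w x 0 \<le> K"
    and t: "t \<ge> 0"
  shows "w x t \<le> K"
proof -
  have *: "w x t - e * t \<le> K" if e: "e > 0" for e
  proof -
    let ?g = "\<lambda>(y, s). w y s - e * s"
    have "continuous_on (cbox 0 (1 :: real ^ 'n) \<times> {0..t}) (\<lambda>p. (\<lambda>(x, t). w x t) p - e * snd p)"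
      by (intro continuous_intros continuous_on_subset[OF cont]) auto
    then have "continuous_on (cbox 0 (1 :: real ^ 'n) \<times> {0..t}) ?g"
      by (simp add: case_prod_unfold)
    moreover have "compact (cbox 0 (1 :: real ^ 'n) \<times> {0..t})"
      by (intro compact_Times compact_cbox compact_Icc)
    moreover have "cbox 0 (1 :: real ^ 'n) \<times> {0..t} \<noteq> {}"
      using t frac_in_cbox by fastforce
    ultimately obtain q where "q \<in> cbox 0 (1 :: real ^ 'n) \<times> {0..t}"
      "\<forall>p\<in>cbox 0 (1 :: real ^ 'n) \<times> {0..t}. ?g p \<le> ?g q"
      using continuous_attains_sup by blast
    moreover obtain y s where q: "q = (y, s)" by (cases q)
    ultimately have s: "0 \<le> s" "s \<le> t" and
      box: "\<And>y' s'. y' \<in> cbox 0 1 \<Longrightarrow> 0 \<le> s' \<Longrightarrow> s' \<le> t \<Longrightarrow> w y' s' - e * s' \<le> w y s - e * s"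
      by auto
    \<comment> \<open>Periodicity turns the maximum over the cube into a maximum over all of
      space.\<close>
    have ys: "w y' s' - e * s' \<le> w y s - e * s" if "0 \<le> s'" "s' \<le> t" for y' s'
      using box[OF frac_in_cbox[of y'] that] periodic1_frac[OF per, of s' y'] that by simp
    have "s = 0"
    proof (rule ccontr)
      assume "s \<noteq> 0"
      with s have "s > 0" by simp
      moreover have "w y' s \<le> w y s" for y' using ys[of s y'] s by simp
      ultimately obtain D where D: "D \<le> 0" "(w y has_real_derivative D) (at s)"
        using max by blast
      have "((\<lambda>s. w y s - e * s) has_real_derivative D - e) (at s)"
        using D(2) by (auto intro!: derivative_eq_intros)
      then obtain d where d: "d > 0" "\<And>h. 0 < h \<Longrightarrow> h < d \<Longrightarrow> w y s - e * s < w y (s - h) - e * (s - h)"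
        using has_real_derivative_neg_dec_left[of _ "D - e" s UNIV] D(1) e by fastforce
      \<comment> \<open>The minimum with \<open>s\<close> keeps the earlier time in the interval
        \<open>{0..t}\<close>.\<close>
      have "w y s - e * s < w y (s - min (d / 2) s) - e * (s - min (d / 2) s)"
        using d(1) \<open>s > 0\<close> by (intro d(2)) auto
      moreover have "0 \<le> s - min (d / 2) s" "s - min (d / 2) s \<le> t"
        using d(1) s by linarith+
      ultimately show False
        using ys[of "s - min (d / 2) s" y] by linarith
    qed
    with ys[of t x] init[of y] t show ?thesis by simp
  qed
  show ?thesis
  proof (cases "t = 0")
    case True
    then show ?thesis using init by simp
  next
    case False
    show ?thesis
    proof (rule ccontr)
      assume "\<not> ?thesis"
      \<comment> \<open>This \<open>e\<close> would give
        \<open>(w x t - K) / 2 \<le> 0\<close>.\<close>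
      then show False using *[of "(w x t - K) / (2 * t)"] t False by (simp add: field_simps)
    qed
  qed
qed

section \<open>Space and time derivatives; the equation in nondivergence form\<close>

lemma partial_eq_ddir:
  assumes "U differentiable (at (x, t))"
  shows "partial i (\<lambda>y. U (y, t)) x = ddir (axis i 1, 0) U (x, t)"
proof -
  have "((\<lambda>s. (x + s *\<^sub>R axis i 1, t)) has_vector_derivative (axis i 1, 0)) (at 0)"
    by (auto intro!: derivative_eq_intros)
  from has_real_derivative_ddir[of U "\<lambda>s. (x + s *\<^sub>R axis i 1, t)", OF _ this] assms
  show ?thesis unfolding partial_def by (simp add: DERIV_imp_deriv)
qed

lemma has_real_derivative_time:
  assumes "U differentiable (at (x, t))"
  shows "((\<lambda>s. U (x, s)) has_real_derivative ddir (0, 1) U (x, t)) (at t)"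
proof -
  have "((\<lambda>s. (x, s)) has_vector_derivative (0, 1)) (at t)"
    by (auto intro!: derivative_eq_intros)
  from has_real_derivative_ddir[of U "\<lambda>s. (x, s)", OF _ this] assms
  show ?thesis by simp
qed

text \<open>Restriction to the line through \<open>x\<close> in direction \<open>v\<close> at the
  fixed time \<open>t\<close> reduces this to one variable. The derivatives are parameters, so that
  the lemma also applies to -u and to |Du|^2, whose derivatives have explicit formulas.\<close>

lemma spatial_max_derivatives:
  fixes f :: "(real ^ 'n) \<times> real \<Rightarrow> real"
  assumes f: "\<And>p. p \<in> UNIV \<times> {0<..} \<Longrightarrow> (f has_derivative f' p) (at p)"
    and f'': "((\<lambda>p. f' p (v, 0)) has_derivative f'') (at (x, t))"
    and max: "\<And>y. f (y, t) \<le> f (x, t)" and "t > 0"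
  shows "f' (x, t) (v, 0) = 0" and "f'' (v, 0) \<le> 0"
proof -
  have line: "((\<lambda>s. (x + s *\<^sub>R v, t)) has_vector_derivative (v, 0)) (at s)" for s
    by (auto intro!: derivative_eq_intros)
  have 1: "((\<lambda>s. f (x + s *\<^sub>R v, t)) has_real_derivative f' (x + s *\<^sub>R v, t) (v, 0)) (at s)" for s
    by (rule has_real_derivative_along[of f _ "\<lambda>s. (x + s *\<^sub>R v, t)", OF f line])
       (use \<open>t > 0\<close> in auto)
  have 2: "((\<lambda>s. f' (x + s *\<^sub>R v, t) (v, 0)) has_real_derivative f'' (v, 0)) (at 0)"
    by (rule has_real_derivative_along[of "\<lambda>p. f' p (v, 0)" _ "\<lambda>s. (x + s *\<^sub>R v, t)", OF _ line])
       (use f'' in simp)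
  from second_derivative_max_le_0[OF 1 2] max
  show "f' (x, t) (v, 0) = 0" and "f'' (v, 0) \<le> 0" by simp_all
qed

text \<open>Product rule, with 1 - 2u as the derivative of u(1 - u).\<close>

lemma divergence_form_eq:
  fixes U :: "(real ^ 'n) \<times> real \<Rightarrow> real"
  assumes C: "Ck_on 2 (UNIV \<times> {0<..}) U" and "t > 0"
  shows "divergence (\<lambda>y. (U (y, t) * (1 - U (y, t))) *\<^sub>R grad (\<lambda>z. U (z, t)) y) x =
    U (x, t) * (1 - U (x, t)) * (\<Sum>i\<in>UNIV. ddir (axis i 1, 0) (ddir (axis i 1, 0) U) (x, t)) +
    (1 - 2 * U (x, t)) * (\<Sum>i\<in>UNIV. (ddir (axis i 1, 0) U (x, t))\<^sup>2)"
proof -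
  have op: "open (UNIV \<times> {0<..} :: ((real ^ 'n) \<times> real) set)" by (intro open_Times) auto
  have C2: "Ck_on (Suc (Suc 0)) (UNIV \<times> {0<..}) U" using C by (simp add: numeral_2_eq_2)
  note U = Ck_on_Suc_open(1)[OF C2 op] and U' = Ck_on_Suc_open(1)[OF Ck_on_Suc_open(2)[OF C2 op] op]
  have "partial i (\<lambda>y. ((U (y, t) * (1 - U (y, t))) *\<^sub>R grad (\<lambda>z. U (z, t)) y) $ i) x =
     U (x, t) * (1 - U (x, t)) * ddir (axis i 1, 0) (ddir (axis i 1, 0) U) (x, t) +
     (1 - 2 * U (x, t)) * (ddir (axis i 1, 0) U (x, t))\<^sup>2" for i
  proof -
    let ?G = "\<lambda>p. U p * (1 - U p) * ddir (axis i 1, 0) U p"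
    have "(\<lambda>y. ((U (y, t) * (1 - U (y, t))) *\<^sub>R grad (\<lambda>z. U (z, t)) y) $ i) = (\<lambda>y. ?G (y, t))"
      using \<open>t > 0\<close> by (simp add: grad_def partial_eq_ddir[OF U])
    moreover have G: "(?G has_derivative (\<lambda>v.
        U (x, t) * (1 - U (x, t)) * ddir v (ddir (axis i 1, 0) U) (x, t) +
        (1 - 2 * U (x, t)) * ddir v U (x, t) * ddir (axis i 1, 0) U (x, t))) (at (x, t))"
      using \<open>t > 0\<close>
      by (auto intro!: derivative_eq_intros has_derivative_ddir U U' simp: algebra_simps)
    ultimately show ?thesis
      using partial_eq_ddir[of ?G x t i] ddir_eq[OF G] differentiableI[OF G]
      by (simp add: power2_eq_square algebra_simps)
  qed
  then show ?thesis
    unfolding divergence_def by (simp add: sum.distrib sum_distrib_left)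
qed

section \<open>Time derivative of |Du|^2 at a spatial maximum\<close>

text \<open>The sum is half the time derivative of |Du|^2. Differentiating the equation in each
  coordinate and using the first and second order conditions at the maximum gives the assumptions of
  \<open>bochner_inequality\<close>.\<close>

lemma gradient_max_time_derivative:
  fixes U :: "(real ^ 'n) \<times> real \<Rightarrow> real"
  assumes C: "Ck_on 3 (UNIV \<times> {0<..}) U"
    and pde: "\<And>p. p \<in> UNIV \<times> {0<..} \<Longrightarrow> ddir (0, 1) U p =
      U p * (1 - U p) * (\<Sum>i\<in>UNIV. ddir (axis i 1, 0) (ddir (axis i 1, 0) U) p) +
      (1 - 2 * U p) * (\<Sum>i\<in>UNIV. (ddir (axis i 1, 0) U p)\<^sup>2)"
    and "t > 0"
    and max: "\<And>y. (\<Sum>k\<in>UNIV. (ddir (axis k 1, 0) U (y, t))\<^sup>2) \<le> (\<Sum>k\<in>UNIV. (ddir (axis k 1, 0) U (x, t))\<^sup>2)"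
    and a: "U (x, t) * (1 - U (x, t)) \<ge> 0"
    and ab: "(1 - 2 * U (x, t))\<^sup>2 * (real CARD('n) - 1) \<le> 8 * (U (x, t) * (1 - U (x, t)))"
  shows "(\<Sum>k\<in>UNIV. ddir (axis k 1, 0) U (x, t) * ddir (0, 1) (ddir (axis k 1, 0) U) (x, t)) \<le> 0"
proof -
  let ?O = "UNIV \<times> {0<..} :: ((real ^ 'n) \<times> real) set"
  define e :: "'n \<Rightarrow> (real ^ 'n) \<times> real" where "e i = (axis i 1, 0)" for i
  have op: "open ?O" by (intro open_Times) auto
  have xt: "(x, t) \<in> ?O" using \<open>t > 0\<close> by simp
  have C3: "Ck_on (Suc (Suc (Suc 0))) ?O U" using C by (simp add: numeral_3_eq_3)
  note U = Ck_on_Suc_open[OF C3 op]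
  note U' = Ck_on_Suc_open[OF U(2) op]
  note U'' = Ck_on_Suc_open[OF U'(2) op]
  have U2: "Ck_on 2 ?O U" and U2': "Ck_on 2 ?O (ddir v U)" for v
    using Ck_on_SucD[OF C3] U(2) by (simp_all add: numeral_2_eq_2)
  have sym: "ddir v (ddir w U) p = ddir w (ddir v U) p" if "p \<in> ?O" for v w p
    by (rule ddir_commute[OF U2 op that])
  have sym3: "ddir v (ddir w (ddir y U)) p = ddir w (ddir v (ddir y U)) p" if "p \<in> ?O" for v w y p
    by (rule ddir_commute[OF U2' op that])
  \<comment> \<open>The inner pair is exchanged under the outer derivative, which is possible
    because symmetry holds on the whole open set; then the outer pair is exchanged for the C^2
    function \<open>ddir (e j) U\<close>.\<close>
  have commute3: "ddir (e j) (ddir (e j) (ddir (e k) U)) (x, t) = ddir (e k) (ddir (e j) (ddir (e j) U)) (x, t)" for j k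
  proof -
    have "ddir (e j) (ddir (e j) (ddir (e k) U)) (x, t) = ddir (e j) (ddir (e k) (ddir (e j) U)) (x, t)"
      by (rule ddir_transform[OF op xt]) (use sym U''(1) xt in auto)
    then show ?thesis using sym3[OF xt] by simp
  qed
  define p where "p k = ddir (e k) U (x, t)" for k
  define H where "H k j = ddir (e j) (ddir (e k) U) (x, t)" for k j
  define T where "T k j = ddir (e j) (ddir (e j) (ddir (e k) U)) (x, t)" for k j
  have T_eq: "T k j = ddir (e k) (ddir (e j) (ddir (e j) U)) (x, t)" for k j
    unfolding T_def by (rule commute3)
  define R where "R k = ddir (0, 1) (ddir (e k) U) (x, t)" for k
  have Z': "((\<lambda>p. \<Sum>k\<in>UNIV. (ddir (e k) U p)\<^sup>2) has_derivative
      (\<lambda>v. \<Sum>k\<in>UNIV. 2 * (ddir (e k) U p * ddir v (ddir (e k) U) p))) (at p)" if "p \<in> ?O" for p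
    using that by (auto intro!: derivative_eq_intros has_derivative_ddir U' simp: algebra_simps)
  have Z'': "((\<lambda>p. \<Sum>k\<in>UNIV. 2 * (ddir (e k) U p * ddir w (ddir (e k) U) p)) has_derivative
      (\<lambda>v. \<Sum>k\<in>UNIV. 2 * (ddir v (ddir (e k) U) (x, t) * ddir w (ddir (e k) U) (x, t) +
         ddir (e k) U (x, t) * ddir v (ddir w (ddir (e k) U)) (x, t)))) (at (x, t))" for w
    using xt by (auto intro!: derivative_eq_intros has_derivative_ddir U'(1) U''(1) simp: algebra_simps)
  \<comment> \<open>Along axis \<open>j\<close>, the first order condition says that
    \<open>H\<close> annihilates Du; the second order condition, summed over \<open>j\<close>, is
    the sign of the Laplacian of |Du|^2.\<close>
  note Zmax = spatial_max_derivatives[OF Z' Z'' max[folded e_def] \<open>t > 0\<close>, of "axis j 1" for j, folded e_def]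
  have orth: "(\<Sum>k\<in>UNIV. p k * H k j) = 0" for j
    using Zmax(1)[of j] by (simp add: p_def H_def sum_distrib_left[symmetric])
  have "(\<Sum>k\<in>UNIV. (H k j)\<^sup>2 + p k * T k j) \<le> 0" for j
    using Zmax(2)[of j]
    unfolding p_def H_def T_def power2_eq_square sum_distrib_left[symmetric] by linarith
  then have "(\<Sum>j\<in>UNIV. \<Sum>k\<in>UNIV. (H k j)\<^sup>2 + p k * T k j) \<le> 0"
    by (rule sum_nonpos)
  then have Tmax: "(\<Sum>k\<in>UNIV. \<Sum>j\<in>UNIV. (H k j)\<^sup>2 + p k * T k j) \<le> 0"
    by (subst sum.swap)
  let ?F = "\<lambda>p. U p * (1 - U p) * (\<Sum>i\<in>UNIV. ddir (e i) (ddir (e i) U) p) +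
      (1 - 2 * U p) * (\<Sum>i\<in>UNIV. (ddir (e i) U p)\<^sup>2)"
  have F: "(?F has_derivative (\<lambda>v.
      U (x, t) * (1 - U (x, t)) * (\<Sum>i\<in>UNIV. ddir v (ddir (e i) (ddir (e i) U)) (x, t)) +
      (1 - 2 * U (x, t)) * ddir v U (x, t) * (\<Sum>i\<in>UNIV. ddir (e i) (ddir (e i) U) (x, t)) +
      ((1 - 2 * U (x, t)) * (\<Sum>i\<in>UNIV. 2 * (p i * ddir v (ddir (e i) U) (x, t))) -
       2 * ddir v U (x, t) * (\<Sum>i\<in>UNIV. (p i)\<^sup>2)))) (at (x, t))"
    unfolding p_def using xt
    by (auto intro!: derivative_eq_intros has_derivative_ddir U(1) U'(1) U''(1) simp: algebra_simps)
  have "R k = U (x, t) * (1 - U (x, t)) * (\<Sum>j\<in>UNIV. T k j) + (1 - 2 * U (x, t)) * p k * (\<Sum>j\<in>UNIV. H j j)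
              + 2 * (1 - 2 * U (x, t)) * (\<Sum>i\<in>UNIV. p i * H i k) - 2 * p k * (\<Sum>i\<in>UNIV. (p i)\<^sup>2)" for k
  proof -
    have "R k = ddir (e k) (ddir (0, 1) U) (x, t)"
      unfolding R_def by (rule sym[OF xt])
    \<comment> \<open>The equation holds on an open set, so both sides have the same
      derivatives.\<close>
    also have "\<dots> = ddir (e k) ?F (x, t)"
      by (rule ddir_transform[OF op xt]) (use pde[folded e_def] U'(1) xt in auto)
    also have "\<dots> = U (x, t) * (1 - U (x, t)) * (\<Sum>j\<in>UNIV. T k j) + (1 - 2 * U (x, t)) * p k * (\<Sum>j\<in>UNIV. H j j)
              + ((1 - 2 * U (x, t)) * (\<Sum>i\<in>UNIV. 2 * (p i * H i k)) - 2 * p k * (\<Sum>i\<in>UNIV. (p i)\<^sup>2))"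
      unfolding ddir_eq[OF F] by (simp only: T_eq H_def p_def)
    finally show ?thesis by (simp add: sum_distrib_left[symmetric])
  qed
  from bochner_inequality[of p H T R, OF orth Tmax this a ab]
  show ?thesis by (simp add: p_def R_def e_def)
qed

section \<open>The gradient up to time 0, and the range of the coefficients\<close>

lemma periodic1_grad: "periodic1 f \<Longrightarrow> periodic1 (grad f)"
  unfolding periodic1_def grad_def partial_def
  by (simp add: add.assoc add.commute[of "axis _ 1"])
    (simp add: add.assoc[symmetric])

text \<open>Horizontal lines stay in the half-space, so spatial partial derivatives are two-sided
  even at time 0. This gives the continuity of |Du|^2 up to the initial time.\<close>

lemma partial_within_half_space:
  assumes U: "(U has_derivative f') (at (x, t) within UNIV \<times> {0..})" and "t \<ge> 0"
  shows "partial i (\<lambda>y. U (y, t)) x = f' (axis i 1, 0)"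
proof -
  let ?l = "\<lambda>s. (x + s *\<^sub>R axis i 1, t)"
  have l: "(?l has_derivative (\<lambda>s. s *\<^sub>R (axis i 1, 0))) (at 0)"
    by (auto intro!: derivative_eq_intros)
  have "(U has_derivative f') (at (?l 0) within range ?l)"
    using U \<open>t \<ge> 0\<close> by (auto intro: has_derivative_subset)
  from has_derivative_in_compose[OF l this]
  have "((\<lambda>s. U (?l s)) has_derivative (\<lambda>s. f' (s *\<^sub>R (axis i 1, 0)))) (at 0)" .
  moreover have "f' (s *\<^sub>R (axis i 1, 0)) = f' (axis i 1, 0) * s" for s
    using bounded_linear.linear[OF has_derivative_bounded_linear[OF U]]
    by (simp only: linear_cmul real_scaleR_def mult.commute)
  ultimately have "((\<lambda>s. U (?l s)) has_real_derivative f' (axis i 1, 0)) (at 0)"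
    by (simp add: has_field_derivative_def)
  then show ?thesis unfolding partial_def by (rule DERIV_imp_deriv)
qed

lemma norm_grad_power2: "(norm (grad f x))\<^sup>2 = (\<Sum>i\<in>UNIV. (partial i f x)\<^sup>2)"
  unfolding power2_norm_eq_inner by (simp add: inner_vec_def grad_def power2_eq_square)

text \<open>In terms of \<open>s = r - 1 / 2\<close> the claims read
  \<open>4 * s\<^sup>2 \<le> 1\<close> and \<open>(2 + 2 * d) * s\<^sup>2 \<le> 1\<close>. The
  second is the bound by \<delta>, and it implies the first since \<open>d \<ge> 1\<close>.\<close>

lemma coefficient_bounds:
  fixes r \<delta> :: real
  assumes \<delta>: "\<delta> = (2 + 2 * real d) powr (- 1 / 2)" and "d \<ge> 1"
    and r: "1 / 2 - \<delta> \<le> r" "r \<le> 1 / 2 + \<delta>"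
  shows "r * (1 - r) \<ge> 0" and "(1 - 2 * r)\<^sup>2 * (real d - 1) \<le> 8 * (r * (1 - r))"
proof -
  define s where "s = r - 1 / 2"
  have "\<delta>\<^sup>2 = 1 / (2 + 2 * real d)"
    unfolding \<delta> by (simp add: power2_eq_square powr_add[symmetric] powr_minus_divide)
  moreover have "s\<^sup>2 \<le> \<delta>\<^sup>2"
    using r unfolding s_def by (intro abs_le_square_iff[THEN iffD1]) linarith
  ultimately have "s\<^sup>2 * (2 + 2 * real d) \<le> 1"
    by (simp add: pos_le_divide_eq)
  then have s: "2 * s\<^sup>2 + 2 * (s\<^sup>2 * real d) \<le> 1" by (simp add: algebra_simps)
  have "s\<^sup>2 * 1 \<le> s\<^sup>2 * real d"
    using \<open>d \<ge> 1\<close> by (intro mult_left_mono) auto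
  with s have "4 * s\<^sup>2 \<le> 1" by linarith
  then show "r * (1 - r) \<ge> 0"
    by (simp add: s_def power2_eq_square algebra_simps)
  have "(1 - 2 * r)\<^sup>2 * (real d - 1) = 4 * (s\<^sup>2 * real d) - 4 * s\<^sup>2" "8 * (r * (1 - r)) = 2 - 8 * s\<^sup>2"
    by (simp_all add: s_def power2_eq_square algebra_simps)
  with s show "(1 - 2 * r)\<^sup>2 * (real d - 1) \<le> 8 * (r * (1 - r))" by linarith
qed

section \<open>Application to the solution\<close>

theorem corollary3p6:
  fixes u :: "real ^ 'n \<Rightarrow> real \<Rightarrow> real"
    and u0 :: "real ^ 'n \<Rightarrow> real"
    and \<delta> u_lo u_hi M :: real
  assumes "\<delta> = (2 + 2 * real CARD('n)) powr (- 1 / 2)"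
    and "u_lo = 1 / 2 - \<delta>"
    and "u_hi = 1 / 2 + \<delta>"
    and "M > 0"
    and "\<forall>t\<ge>0. periodic1 (\<lambda>x. u x t)"
    and "Ck_on 3 (UNIV \<times> {0..}) (\<lambda>(x, t). u x t)"
    and "\<forall>x. \<forall>t>0. deriv (\<lambda>s. u x s) t =
           divergence (\<lambda>y. (u y t * (1 - u y t)) *\<^sub>R grad (\<lambda>z. u z t) y) x"
    and "\<forall>x. u x 0 = u0 x"
    and "\<forall>t\<ge>0. (\<forall>x. u_lo \<le> u x t \<and> u x t \<le> u_hi) \<and> sup_norm (grad (\<lambda>x. u x t)) \<le> M"
  shows "\<forall>t\<ge>0. (\<forall>x. (LEAST m. m \<in> range u0) \<le> u x t \<and> u x t \<le> (GREATEST m. m \<in> range u0)) \<and>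
           sup_norm (grad (\<lambda>x. u x t)) \<le> sup_norm (grad u0)"
proof -
  let ?S = "UNIV \<times> {0..} :: ((real ^ 'n) \<times> real) set"
  let ?O = "UNIV \<times> {0<..} :: ((real ^ 'n) \<times> real) set"
  define U where "U = (\<lambda>(x, t). u x t)"
  have [simp]: "U (x, t) = u x t" for x t by (simp add: U_def)
  have C: "Ck_on 3 ?S U" using assms(6) by (simp add: U_def)
  have CO: "Ck_on 3 ?O U" by (rule Ck_on_subset[OF C]) auto
  have op: "open ?O" by (intro open_Times) auto
  have C3: "Ck_on (Suc (Suc (Suc 0))) ?O U" using CO by (simp add: numeral_3_eq_3)
  note dU = Ck_on_Suc_open[OF C3 op]
  note dU' = Ck_on_Suc_open[OF dU(2) op]
  have C2: "Ck_on 2 ?O U" using Ck_on_SucD[OF C3] by (simp add: numeral_2_eq_2)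
  have cont: "continuous_on ?S U" using C by (rule Ck_on_imp_continuous_on)
  have u0: "u0 = (\<lambda>x. u x 0)" using assms(8) by auto
  have per: "periodic1 (\<lambda>x. u x t)" if "t \<ge> 0" for t using assms(5) that by blast
  have at_0: "continuous_on UNIV (\<lambda>x. f (x, 0))" if "continuous_on ?S f" for f :: "_ \<Rightarrow> real"
    by (rule continuous_on_compose2[OF that]) (auto intro!: continuous_intros)
  have a: "u x t * (1 - u x t) \<ge> 0"
    and ab: "(1 - 2 * u x t)\<^sup>2 * (real CARD('n) - 1) \<le> 8 * (u x t * (1 - u x t))" if "t \<ge> 0" for x t
    using coefficient_bounds[OF assms(1), of "u x t"] assms(2,3,9) that by (auto simp: Suc_le_eq)
  have time: "(u x has_real_derivative ddir (0, 1) U (x, t)) (at t)" if "t > 0" for x t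
    using has_real_derivative_time[OF dU(1), of x t] that by simp
  have pde: "ddir (0, 1) U p =
      U p * (1 - U p) * (\<Sum>i\<in>UNIV. ddir (axis i 1, 0) (ddir (axis i 1, 0) U) p) +
      (1 - 2 * U p) * (\<Sum>i\<in>UNIV. (ddir (axis i 1, 0) U p)\<^sup>2)" if "p \<in> ?O" for p
  proof -
    obtain x t where p: "p = (x, t)" "t > 0" using \<open>p \<in> ?O\<close> by (cases p) auto
    have "ddir (0, 1) U p = deriv (\<lambda>s. u x s) t"
      using time[OF p(2), of x] unfolding p(1) by (rule DERIV_imp_deriv[symmetric])
    with assms(7) divergence_form_eq[OF C2 p(2), of x] p show ?thesis by simp
  qed

  \<comment> \<open>Bounds on u by its initial extrema\<close>
  have "compact (range u0)"
    using compact_range_periodic1[OF per[of 0] at_0[OF cont, simplified]] by (simp add: u0)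
  then obtain lo hi where lo: "lo \<in> range u0" "\<And>m. m \<in> range u0 \<Longrightarrow> lo \<le> m"
    and hi: "hi \<in> range u0" "\<And>m. m \<in> range u0 \<Longrightarrow> m \<le> hi"
    using compact_attains_inf[of "range u0"] compact_attains_sup[of "range u0"] by auto
  have Least: "(LEAST m. m \<in> range u0) = lo" using lo by (rule Least_equality)
  have Greatest: "(GREATEST m. m \<in> range u0) = hi" using hi by (rule Greatest_equality)

  have upper: "u x t \<le> hi" if "t \<ge> 0" for x t
  proof (rule periodic_maximum_principle[OF _ per _ _ that])
    show "continuous_on ?S (\<lambda>(x, t). u x t)" using cont by (simp add: U_def)
    show "u x 0 \<le> hi" for x using hi(2) assms(8) by auto
    fix x t assume t: "t > (0 :: real)" and max: "\<And>y. u y t \<le> u x t"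
    note m = spatial_max_derivatives[OF has_derivative_ddir[OF dU(1)] has_derivative_ddir[OF dU'(1)] _ t, of x]
    have "ddir (axis i 1, 0) U (x, t) = 0" "ddir (axis i 1, 0) (ddir (axis i 1, 0) U) (x, t) \<le> 0" for i
      using m[of "axis i 1"] t max by auto
    \<comment> \<open>Where Du vanishes, only the Laplacian term of the equation is left, and its
      coefficient is nonnegative.\<close>
    then have "ddir (0, 1) U (x, t) \<le> 0"
      using pde[of "(x, t)"] a[of t x] t by (simp add: mult_nonneg_nonpos sum_nonpos)
    with time[OF t] show "\<exists>D\<le>0. (u x has_real_derivative D) (at t)" by blast
  qed
  have lower: "- u x t \<le> - lo" if "t \<ge> 0" for x t
  proof (rule periodic_maximum_principle[OF _ _ _ _ that])
    show "continuous_on ?S (\<lambda>(x, t). - u x t)"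
      using continuous_on_minus[OF cont] by (simp add: U_def case_prod_unfold)
    show "- u x 0 \<le> - lo" for x using lo(2) assms(8) by auto
    show "periodic1 (\<lambda>x. - u x t)" if "t \<ge> 0" for t
      using per[OF that] by (simp add: periodic1_def)
    fix x t assume t: "t > (0 :: real)" and max: "\<And>y. - u y t \<le> - u x t"
    note m = spatial_max_derivatives[OF has_derivative_minus[OF has_derivative_ddir[OF dU(1)]]
        has_derivative_minus[OF has_derivative_ddir[OF dU'(1)]] _ t, of x]
    have "ddir (axis i 1, 0) U (x, t) = 0" "ddir (axis i 1, 0) (ddir (axis i 1, 0) U) (x, t) \<ge> 0" for i
      using m[of "axis i 1"] t max by auto
    then have "ddir (0, 1) U (x, t) \<ge> 0"
      using pde[of "(x, t)"] a[of t x] t by (simp add: sum_nonneg)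
    then show "\<exists>D\<le>0. ((\<lambda>t. - u x t) has_real_derivative D) (at t)"
      using DERIV_minus[OF time[OF t, of x]] by (intro exI[of _ "- ddir (0, 1) U (x, t)"]) auto
  qed

  \<comment> \<open>Bound on the gradient\<close>
  \<comment> \<open>The derivative within the closed half-space describes |Du|^2 continuously down
    to time 0; \<open>ddir\<close> is used only for positive times.\<close>
  obtain U' where U': "\<And>p. p \<in> ?S \<Longrightarrow> (U has_derivative U' p) (at p within ?S)"
    "\<And>v. Ck_on 2 ?S (\<lambda>p. U' p v)"
    using C unfolding numeral_3_eq_3 Ck_on.simps(2)[of "Suc (Suc 0)"] by (auto simp: numeral_2_eq_2)
  define w where "w x t = (norm (grad (\<lambda>x. u x t) x))\<^sup>2" for x t
  have w: "w x t = (\<Sum>i\<in>UNIV. (U' (x, t) (axis i 1, 0))\<^sup>2)" if "t \<ge> 0" for x t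
    using partial_within_half_space[OF U'(1), of x t] that by (simp add: w_def norm_grad_power2)
  have wO: "w x t = (\<Sum>i\<in>UNIV. (ddir (axis i 1, 0) U (x, t))\<^sup>2)" if "t > 0" for x t
    using partial_eq_ddir[OF dU(1), of x t] that by (simp add: w_def norm_grad_power2)
  have "continuous_on ?S (\<lambda>p. \<Sum>i\<in>UNIV. (U' p (axis i 1, 0))\<^sup>2)"
    by (intro continuous_intros Ck_on_imp_continuous_on[OF U'(2)])
  then have w_cont: "continuous_on ?S (\<lambda>(x, t). w x t)"
    by (rule continuous_on_eq) (auto simp: w)
  have w_per: "periodic1 (\<lambda>x. w x t)" if "t \<ge> 0" for t
    using periodic1_grad[OF per[OF that]] by (simp add: periodic1_def w_def)

  have "periodic1 (\<lambda>x. norm (grad u0 x))"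
    using periodic1_grad[OF per[of 0]] by (simp add: periodic1_def u0)
  moreover have "continuous_on UNIV (\<lambda>x. sqrt (w x 0))"
    using at_0[OF w_cont] by (intro continuous_intros) simp
  then have "continuous_on UNIV (\<lambda>x. norm (grad u0 x))"
    by (simp add: w_def u0)
  \<comment> \<open>A real-valued supremum dominates the values only once they are known to be
    bounded.\<close>
  ultimately have "bdd_above (range (\<lambda>x. norm (grad u0 x)))"
    by (intro bounded_imp_bdd_above compact_imp_bounded compact_range_periodic1)
  then have sup: "norm (grad u0 x) \<le> sup_norm (grad u0)" for x
    unfolding sup_norm_def by (rule cSUP_upper[OF UNIV_I])

  have w_le: "w x t \<le> (sup_norm (grad u0))\<^sup>2" if "t \<ge> 0" for x t
  proof (rule periodic_maximum_principle[OF w_cont w_per _ _ that])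
    show "w x 0 \<le> (sup_norm (grad u0))\<^sup>2" for x
      using sup[of x] by (simp add: w_def u0 power_mono)
    fix x t assume t: "t > (0 :: real)" and max: "\<And>y. w y t \<le> w x t"
    let ?D = "\<Sum>k\<in>UNIV. ddir (axis k 1, 0) U (x, t) * ddir (0, 1) (ddir (axis k 1, 0) U) (x, t)"
    have "?D \<le> 0"
      by (rule gradient_max_time_derivative[OF CO pde t])
         (use max t a[of t x] ab[of t x] in \<open>simp_all add: wO\<close>)
    moreover have "((\<lambda>s. \<Sum>k\<in>UNIV. (ddir (axis k 1, 0) U (x, s))\<^sup>2) has_real_derivative
       (\<Sum>k\<in>UNIV. 2 * (ddir (axis k 1, 0) U (x, t) * ddir (0, 1) (ddir (axis k 1, 0) U) (x, t)))) (at t)"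
      using t by (auto intro!: derivative_eq_intros has_real_derivative_time dU'(1) simp: algebra_simps)
    \<comment> \<open>The formula \<open>wO\<close> holds for positive times, an open set, which
      suffices to differentiate \<open>w\<close> in time.\<close>
    then have "(w x has_real_derivative 2 * ?D) (at t)"
      unfolding sum_distrib_left[symmetric]
      by (rule has_field_derivative_transform_within_open[of _ _ _ "{0<..}"]) (use t in \<open>auto simp: wO\<close>)
    ultimately show "\<exists>D\<le>0. (w x has_real_derivative D) (at t)"
      by (intro exI[of _ "2 * ?D"]) auto
  qed
  \<comment> \<open>Needed to pass from squares back to norms.\<close>
  have "sup_norm (grad u0) \<ge> 0" using sup norm_ge_zero order_trans by blast
  then have "norm (grad (\<lambda>x. u x t) x) \<le> sup_norm (grad u0)" if "t \<ge> 0" for x t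
    using w_le[OF that, of x] unfolding w_def by (rule power2_le_imp_le[rotated])
  then have "sup_norm (grad (\<lambda>x. u x t)) \<le> sup_norm (grad u0)" if "t \<ge> 0" for t
    using that unfolding sup_norm_def[of "grad (\<lambda>x. u x t)"] by (intro cSUP_least) auto
  with upper lower show ?thesis unfolding Least Greatest by auto
qed

end
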